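(* Let $c\geq 3$. Then for every positive integer $n$, $\mathcal{G}_{\{1,2c\}}(n)=\mathcal{G}_{\{1,6\}}(\phi_1(n))$.
   Context: For a set $\mathcal{C}$ of positive integers, $\mathcal{G}_{\mathcal{C}}$ is defined recursively by $\mathcal{G}_{\mathcal{C}}(n)=\operatorname{mex}\{\mathcal{G}_{\mathcal{C}}(h_0)\oplus\cdots\oplus\mathcal{G}_{\mathcal{C}}(h_d): d\in\mathcal{C}, h_i\geq 1 \text{ integers}, \sum h_i=n\}$, with $\oplus$ bitwise XOR and mex the least nonnegative integer not in the set (the nim-sequence of the game \textsc{cut} with cut-set $\mathcal{C}$). For $c\geq 3$ and $1\le r\le 2c$, define $r'=1$ if $r=1$; $r'=2$ if $r=2$; $r'=3$ if $2<r<2c-1$ and $r$ odd; $r'=4$ if $2<r<2c-1$ and $r$ even; $r'=5$ if $r=2c-1$; $r'=6$ if $r=2c$. For $p\geq 1$ and $n\geq p$, write uniquely $n=2cq+r+p-1$ with $q\geq 0$, $1\le r\le 2c$, and set $\phi_p(n)=6q+r'+p-1$. In particular $\phi_1(2cq+r)=6q+r'$. *)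

theory Defs
  imports Main
begin

definition mex :: "nat set \<Rightarrow> nat" where
  "mex S = (LEAST k. k \<notin> S)"

text \<open>
  The options of a heap of size \<open>n\<close>, as lists \<open>[h\<^sub>0, \<dots>, h\<^sub>d]\<close>.  The guard \<open>1 \<le> d\<close> says that cut-sets
  consist of positive integers; it is built in so that the recursion below terminates for every set.
\<close>

definition cut_moves :: "nat set \<Rightarrow> nat \<Rightarrow> nat list set" where
  "cut_moves C n =
    {hs. (\<exists>d\<in>C. 1 \<le> d \<and> length hs = d + 1) \<and> (\<forall>h\<in>set hs. 1 \<le> h) \<and> sum_list hs = n}"

lemma cut_moves_less:
  assumes "hs \<in> cut_moves C n" and "h \<in> set hs"
  shows "h < n"
proof -
  from assms(2) obtain xs ys where hs: "hs = xs @ h # ys"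
    by (meson split_list)
  from assms(1) have len: "2 \<le> length hs" and pos: "\<forall>h\<in>set hs. 1 \<le> h" and sum: "sum_list hs = n"
    by (auto simp: cut_moves_def)
  from len hs obtain x where x: "x \<in> set (xs @ ys)"
    by (cases "xs @ ys") auto
  have "x \<le> sum_list (xs @ ys)"
    using x by (rule member_le_sum_list) simp
  moreover have "1 \<le> x" using pos x hs by auto
  ultimately show ?thesis using sum hs by simp
qed

function nim_seq :: "nat set \<Rightarrow> nat \<Rightarrow> nat" where
  "nim_seq C n = mex ((\<lambda>hs. foldr xor (map (nim_seq C) hs) 0) ` cut_moves C n)"
  by auto
termination
  by (relation "measure snd") (auto intro: cut_moves_less)

declare nim_seq.simps [simp del]

lemma nim_seq_eq_mex:
  assumes "0 \<notin> C"
  shows "nim_seq C n = mex {foldr xor (map (nim_seq C) hs) 0 | hs d.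
    d \<in> C \<and> length hs = d + 1 \<and> (\<forall>h\<in>set hs. 1 \<le> h) \<and> sum_list hs = n}"
proof -
  have "1 \<le> d" if "d \<in> C" for d
    using assms that by (cases d) auto
  then show ?thesis
    by (subst nim_seq.simps, intro arg_cong [where f = mex]) (auto simp: cut_moves_def image_def)
qed

definition reduced_residue :: "nat \<Rightarrow> nat \<Rightarrow> nat" where
  "reduced_residue c r =
    (if r = 1 then 1
     else if r = 2 then 2
     else if 2 < r \<and> r < 2 * c - 1 \<and> odd r then 3
     else if 2 < r \<and> r < 2 * c - 1 \<and> even r then 4
     else if r = 2 * c - 1 then 5
     else 6)"

text \<open>
  For \<open>1 \<le> p \<le> n\<close>, the decomposition \<open>n = 2 c q + r + p - 1\<close> with \<open>1 \<le> r \<le> 2 c\<close> amounts to division of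
  \<open>n - p\<close> by \<open>2 c\<close> with remainder \<open>r - 1\<close>.
\<close>

definition phi :: "nat \<Rightarrow> nat \<Rightarrow> nat \<Rightarrow> nat" where
  "phi c p n =
    (let q = (n - p) div (2 * c); r = (n - p) mod (2 * c) + 1
     in 6 * q + reduced_residue c r + p - 1)"

lemma phi_eq:
  assumes "1 \<le> p" "1 \<le> r" "r \<le> 2 * c" "n = 2 * c * q + r + p - 1"
  shows "phi c p n = 6 * q + reduced_residue c r + p - 1"
proof -
  have "n - p = 2 * c * q + (r - 1)" and "r - 1 < 2 * c"
    using assms by auto
  then have "(n - p) div (2 * c) = q" and "(n - p) mod (2 * c) = r - 1"
    by simp_all
  then show ?thesis
    using assms(2) by (simp add: phi_def)
qed

end

theory Submission
  imports Defs
begin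

text \<open>
  Both sequences have a closed form: the one for \<open>{1, 2 * c}\<close> is arithmetically periodic with period
  \<open>12 * c\<close> and saltus \<open>8\<close>, and depends on \<open>n = 2 * c * q + r\<close> only through the row \<open>q\<close>, the parity of
  \<open>r\<close> and whether \<open>r = 1\<close>; the map \<open>\<phi>\<^sub>1\<close> preserves these data.

  No option has the value of \<open>n\<close>: since a xor is at most the sum, the parts of the values divisible by
  \<open>8\<close> reduce the claim to the first period.  There the bit of weight \<open>2\<close> fixes the parity of the sum
  of the rows, the bit of weight \<open>1\<close> fixes the parity of the number of heaps in rows \<open>2\<close> and \<open>3\<close>, and
  the bit of weight \<open>4\<close> gives the contradiction.  The smaller values are reached by cuts into two
  heaps, or into three heaps together with two equal ones and an even number of heaps of size \<open>1\<close>.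
\<close>

section \<open>Closed form of the nim-sequence for \<open>{1, 2 * c}\<close>\<close>

definition row :: "nat \<Rightarrow> nat \<Rightarrow> nat" where
  "row c n = (n - 1) div (2 * c)"

definition col :: "nat \<Rightarrow> nat \<Rightarrow> nat" where
  "col c n = (n - 1) mod (2 * c) + 1"

text \<open>The three summands are the bits of weight 4, 2 and 1, each with its own formula because
  xor acts on every bit separately.\<close>

definition period_val :: "nat \<Rightarrow> nat \<Rightarrow> nat" where
  "period_val R r = 4 * of_bool (R \<in> {4, 5} \<or> R = 2 \<and> r \<noteq> 1) + 2 * (R mod 2)
    + of_bool (odd r = (R \<in> {2, 3}))"

definition cut_val :: "nat \<Rightarrow> nat \<Rightarrow> nat" where
  "cut_val c n = 8 * (row c n div 6) + period_val (row c n mod 6) (col c n)"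

definition options :: "nat \<Rightarrow> nat \<Rightarrow> nat set" where
  "options c n = (\<lambda>hs. foldr xor (map (cut_val c) hs) 0) ` cut_moves {1, 2 * c} n"

lemma mex_eqI:
  assumes "v \<notin> S" and "\<And>w. w < v \<Longrightarrow> w \<in> S"
  shows "mex S = v"
  unfolding mex_def using assms by (intro Least_equality) (auto simp: not_less [symmetric])

lemma period_val_less: "period_val R r < 8"
  unfolding period_val_def by (cases "even R") (auto simp: odd_iff_mod_2_eq_one)

lemma row_col:
  assumes "1 \<le> r" "r \<le> 2 * c"
  shows "row c (2 * c * q + r) = q" and "col c (2 * c * q + r) = r"
proof -
  have "r - 1 < 2 * c" using assms by auto
  then have "(2 * c * q + (r - 1)) div (2 * c) = q" "(2 * c * q + (r - 1)) mod (2 * c) = r - 1"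
    by simp_all
  then show "row c (2 * c * q + r) = q" and "col c (2 * c * q + r) = r"
    using assms unfolding row_def col_def by (metis Nat.add_diff_assoc,
        metis Nat.add_diff_assoc le_add_diff_inverse2)
qed

lemma row_col_decomp:
  assumes "1 \<le> n" "1 \<le> c"
  shows "n = 2 * c * row c n + col c n" and "1 \<le> col c n" and "col c n \<le> 2 * c"
proof -
  have "2 * c * row c n + (n - 1) mod (2 * c) = n - 1"
    by (simp add: row_def)
  then show "n = 2 * c * row c n + col c n" using assms by (simp add: col_def)
  show "1 \<le> col c n" by (simp add: col_def)
  have "(n - 1) mod (2 * c) < 2 * c" using assms by simp
  then show "col c n \<le> 2 * c" by (simp add: col_def)
qed

lemma cut_val_eq:
  assumes "1 \<le> r" "r \<le> 2 * c" "R < 6" "n = 12 * c * k + 2 * c * R + r"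
  shows "cut_val c n = 8 * k + period_val R r"
proof -
  have n: "n = 2 * c * (6 * k + R) + r" using assms by (simp add: algebra_simps)
  show ?thesis unfolding cut_val_def n using assms by (simp add: row_col)
qed

section \<open>Xor of natural numbers, split at the bit of weight 8\<close>

lemma xor_8:
  assumes "u < 8" "t < 8"
  shows "xor (8 * k + u) (8 * l + t) = 8 * xor k l + xor u (t::nat)"
proof -
  let ?x = "xor (8 * k + u) (8 * l + t)"
  have "?x div 8 = xor k l"
    using drop_bit_xor [of 3 "8 * k + u" "8 * l + t"] assms by (simp add: drop_bit_eq_div)
  moreover have "?x mod 8 = xor u t"
    using take_bit_xor [of 3 "8 * k + u" "8 * l + t"] assms by (simp add: take_bit_eq_mod)
  ultimately show ?thesis using mult_div_mod_eq [of 8 ?x] by simp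
qed

text \<open>Xor is addition without carries; the induction strips the lowest bit of both
  arguments.\<close>

lemma xor_le_add: "xor a b \<le> a + (b::nat)"
proof (induction a arbitrary: b rule: less_induct)
  case (less a)
  show ?case
  proof (cases "a = 0")
    case False
    have "xor a b = of_bool (odd a \<noteq> odd b) + 2 * xor (a div 2) (b div 2)"
      by (rule xor_rec)
    moreover have "xor (a div 2) (b div 2) \<le> a div 2 + b div 2"
      using False by (intro less) simp
    ultimately show ?thesis by (cases "even a"; cases "even b") (auto elim!: evenE oddE)
  qed simp
qed

lemma foldr_xor_le_sum: "foldr xor xs 0 \<le> sum_list (xs :: nat list)"
  by (induction xs) (auto intro: order_trans [OF xor_le_add])

lemma xor_less_8: "u < 8 \<Longrightarrow> t < 8 \<Longrightarrow> xor u t < (8::nat)"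
  using take_bit_xor [of 3 u t] take_bit_nat_eq_self [of u 3] take_bit_nat_eq_self [of t 3]
    take_bit_nat_less_exp [of 3 "xor u t"] by simp

text \<open>The bound 8 is part of the claim because the induction step applies \<open>xor_8\<close>
  to the tail.\<close>

lemma foldr_xor_8:
  assumes "\<And>h. h \<in> set hs \<Longrightarrow> v h < 8"
  shows "foldr xor (map (\<lambda>h. 8 * k h + v h) hs) 0
      = 8 * foldr xor (map k hs) 0 + foldr xor (map v hs) (0::nat)
    \<and> foldr xor (map v hs) 0 < 8"
  using assms by (induction hs) (auto simp: xor_8 xor_less_8)

lemma xor_div_2: "xor a b div 2 = xor (a div 2) (b div (2::nat))"
  using drop_bit_xor [of 1 a b] by (simp add: drop_bit_eq_div)

section \<open>No option attains the closed-form value\<close>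

lemma even_period_val: "even (period_val R r) \<longleftrightarrow> (odd r \<longleftrightarrow> R \<notin> {2, 3})"
  by (simp add: period_val_def)

lemma period_val_div_2:
  "period_val R r div 2 = 2 * of_bool (R \<in> {4, 5} \<or> R = 2 \<and> r \<noteq> 1) + R mod 2"
  unfolding period_val_def by (cases "odd r = (R \<in> {2, 3})") simp_all

lemma even_period_val_div_2: "even (period_val R r div 2) = even R"
  by (simp add: period_val_div_2)

text \<open>Modulo 2, a heap contributes its column plus one, and one more if its row is 2 or
  3.\<close>

lemma even_xor_period_val:
  "even (foldr xor (map (\<lambda>h. period_val (R h) (r h)) hs) 0)
    \<longleftrightarrow> even (sum_list (map r hs) + length hs + length (filter (\<lambda>h. R h \<in> {2, 3}) hs))"
  by (induction hs) (auto simp: even_period_val even_xor_iff)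

lemma even_xor_period_val_div_2:
  "even (foldr xor (map (\<lambda>h. period_val (R h) (r h)) hs) 0 div 2) \<longleftrightarrow> even (sum_list (map R hs))"
  by (induction hs) (simp_all add: xor_div_2 even_xor_iff even_period_val_div_2)

lemma length_filter_rows_le:
  "2 * length (filter (\<lambda>h. R h \<in> {2, 3}) hs) \<le> sum_list (map (R :: _ \<Rightarrow> nat) hs)"
  by (induction hs) auto

lemma xor_less_4: "u < 4 \<Longrightarrow> t < 4 \<Longrightarrow> xor u t < (4::nat)"
  using take_bit_xor [of 2 u t] take_bit_nat_eq_self [of u 2] take_bit_nat_eq_self [of t 2]
    take_bit_nat_less_exp [of 2 "xor u t"] by simp

lemma xor_period_val_less_4:
  assumes "sum_list (map R hs) \<le> 3" "filter (\<lambda>h. R h \<in> {2, 3}) hs = []"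
  shows "foldr xor (map (\<lambda>h. period_val (R h) (r h)) hs) 0 < 4"
  using assms
proof (induction hs)
  case (Cons h hs)
  have "R h \<le> 3" "R h \<noteq> 2" "R h \<noteq> 3" using Cons.prems by (auto split: if_splits)
  then have "R h = 0 \<or> R h = 1" by linarith
  then have "period_val (R h) (r h) < 4" by (auto simp: period_val_def)
  then show ?case using Cons by (simp add: xor_less_4 split: if_splits)
qed simp

text \<open>The columns of so many heaps overflow a row, and the bit of weight 2 makes the row sum
  drop by at least 2, hence to at most 3. The bit of weight 1 excludes heaps in rows 2 and 3 and
  leaves 4 and 5 for \<open>S\<close>, whose values have the bit of weight 4 that the xor
  lacks.\<close>

lemma period_val_no_option_odd:
  assumes "odd (length hs)" "2 * c < length hs" "s \<le> 2 * c" "S < 6"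
    and "\<And>h. h \<in> set hs \<Longrightarrow> 1 \<le> r h"
    and sum: "2 * c * sum_list (map R hs) + sum_list (map r hs) = 2 * c * S + s"
  shows "foldr xor (map (\<lambda>h. period_val (R h) (r h)) hs) 0 \<noteq> period_val S s"
proof
  let ?X = "foldr xor (map (\<lambda>h. period_val (R h) (r h)) hs) 0"
  let ?n = "length (filter (\<lambda>h. R h \<in> {2, 3}) hs)"
  let ?T = "sum_list (map R hs)"
  assume eq: "?X = period_val S s"
  have "length hs \<le> sum_list (map r hs)"
    using assms(5) by (induction hs) fastforce+
  then have "2 * c * ?T < 2 * c * S" using assms by linarith
  then have "?T < S" by simp
  have "even (sum_list (map r hs)) = even s"
    using arg_cong [OF sum, of even] by simp
  \<comment> \<open>The number of heaps is odd and their columns sum to the parity of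
    \<open>s\<close>, so in the lowest bit only the rows 2 and 3 remain.\<close>
  then have n: "even ?n = (S \<notin> {2, 3})"
    using even_xor_period_val [of R r hs] \<open>odd (length hs)\<close>
      eq even_period_val [of S s] \<open>even (sum_list (map r hs)) = even s\<close>
    by auto
  have "even ?T = even S"
    using even_xor_period_val_div_2 [of R r hs] eq even_period_val_div_2 [of S s] by simp
  then have "?T + 2 \<le> S" using \<open>?T < S\<close> by (auto elim!: evenE oddE intro: ccontr)
  have n0: "?n = 0"
  proof -
    have "2 * ?n \<le> ?T" by (rule length_filter_rows_le)
    then have "?n = 0 \<or> ?n = 1" using \<open>?T + 2 \<le> S\<close> \<open>S < 6\<close> by linarith
    \<comment> \<open>One heap in these rows makes \<open>?T\<close> at least 2, hence
      \<open>S\<close> at least 4.\<close>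
    moreover have "S \<notin> {2, 3}" if "?n = 1"
      using \<open>2 * ?n \<le> ?T\<close> \<open>?T + 2 \<le> S\<close> that by auto
    ultimately show ?thesis using n by auto
  qed
  then have "S \<notin> {2, 3}" using n by simp
  then have "S \<in> {4, 5}" using \<open>?T + 2 \<le> S\<close> \<open>S < 6\<close> by auto
  then have "4 \<le> ?X" using eq by (auto simp: period_val_def)
  moreover have "?X < 4"
    using n0 \<open>?T + 2 \<le> S\<close> \<open>S < 6\<close>
    by (intro xor_period_val_less_4) (linarith, simp only: length_0_conv)
  ultimately show False by simp
qed

text \<open>Size leaves \<open>S = A + B\<close> or \<open>S = A + B + 1\<close>, and the bit of
  weight 2 rules out the latter. The lowest bit then leaves only the row sums 1 + 1 and 1 + 3, where
  both heaps lack the bit of weight 4.\<close>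

lemma period_val_no_option_2:
  assumes "a \<ge> 1" "b \<ge> 1" "a \<le> 2 * c" "b \<le> 2 * c" "1 \<le> s" "s \<le> 2 * c" "S < 6"
    and sum: "2 * c * (A + B) + (a + b) = 2 * c * S + s"
  shows "xor (period_val A a) (period_val B b) \<noteq> period_val S s"
proof
  assume eq: "xor (period_val A a) (period_val B b) = period_val S s"
  have "2 * c * (A + B) < 2 * c * (S + 1)" "2 * c * S < 2 * c * (A + B + 2)"
    using assms by (auto simp: algebra_simps)
  then have "A + B < S + 1" "S < A + B + 2" by (simp_all only: mult_less_cancel1)
  have "even (A + B) = even S"
    using xor_div_2 [of "period_val A a" "period_val B b"] eq
    by (metis even_add even_xor_iff even_period_val_div_2)
  then have S: "S = A + B" using \<open>A + B < S + 1\<close> \<open>S < A + B + 2\<close> by presburger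
  then have s: "s = a + b" using sum by simp
  have "even (period_val A a) = even (period_val B b) \<longleftrightarrow> even (period_val S s)"
    using even_xor_iff [of "period_val A a" "period_val B b"] eq by simp
  then have "(A = 2 \<or> A = 3) = (B = 2 \<or> B = 3) \<longleftrightarrow> S = 2 \<or> S = 3"
    unfolding even_period_val s by auto
  then have "(A = 1 \<or> A = 3) \<and> (B = 1 \<or> B = 3) \<and> (S = 2 \<or> S = 4)"
    using S \<open>S < 6\<close> by presburger
  then have *: "A \<in> {1, 3}" "B \<in> {1, 3}" "S \<in> {2, 4}" by simp_all
  have "period_val R r < 4" if "R \<in> {1, 3}" for R r
    using that by (auto simp: period_val_def)
  then have "xor (period_val A a) (period_val B b) < 4" using * by (intro xor_less_4) auto
  \<comment> \<open>Since \<open>s = a + b\<close> is at least 2, the exceptional column 1 of row 2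
    does not occur.\<close>
  moreover have "4 \<le> period_val S s"
    using *(3) s assms(1,2) by (auto simp: period_val_def)
  ultimately show False using eq by simp
qed

text \<open>Each heap splits into full periods, full rows and a column; the list \<open>[n]\<close>
  gives the decomposition of a single heap.\<close>

lemma sum_list_row_col:
  assumes "1 \<le> c" "\<forall>h\<in>set hs. 1 \<le> h"
  shows "sum_list hs = 12 * c * (\<Sum>h\<leftarrow>hs. row c h div 6)
    + (2 * c * (\<Sum>h\<leftarrow>hs. row c h mod 6) + sum_list (map (col c) hs))"
  using assms(2)
proof (induction hs)
  case (Cons h hs)
  have "2 * c * row c h = 2 * c * (6 * (row c h div 6) + row c h mod 6)" by simp
  also have "\<dots> = 12 * c * (row c h div 6) + 2 * c * (row c h mod 6)"
    unfolding distrib_left by simp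
  finally have "h = 12 * c * (row c h div 6) + (2 * c * (row c h mod 6) + col c h)"
    using row_col_decomp(1) [of h c] assms(1) Cons.prems by simp
  then show ?case using Cons by (simp add: algebra_simps)
qed simp

lemma cut_val_not_option:
  assumes "1 \<le> c" "1 \<le> n"
  shows "cut_val c n \<notin> options c n"
proof
  define K R where "K = (\<lambda>h. row c h div 6)" and "R = (\<lambda>h. row c h mod 6)"
  let ?v = "\<lambda>h. period_val (R h) (col c h)"
  assume "cut_val c n \<in> options c n"
  then obtain hs where hs: "hs \<in> cut_moves {1, 2 * c} n"
    and eq: "cut_val c n = foldr xor (map (cut_val c) hs) 0" by (auto simp: options_def)
  then have len: "length hs = 2 \<or> length hs = 2 * c + 1" and pos: "\<forall>h\<in>set hs. 1 \<le> h"
    and sum: "sum_list hs = n" by (auto simp: cut_moves_def)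
  let ?K = "sum_list (map K hs)" and ?R = "sum_list (map R hs)" and ?r = "sum_list (map (col c) hs)"
  have v: "cut_val c = (\<lambda>h. 8 * K h + ?v h)" by (simp add: cut_val_def K_def R_def fun_eq_iff)
  have *: "foldr xor (map (cut_val c) hs) 0 = 8 * foldr xor (map K hs) 0 + foldr xor (map ?v hs) 0
      \<and> foldr xor (map ?v hs) 0 < 8"
    unfolding v by (rule foldr_xor_8) (rule period_val_less)
  have "?v n < 8" by (rule period_val_less)
  moreover have cut_val_n: "cut_val c n = 8 * K n + ?v n" by (simp add: v)
  ultimately have Kn: "foldr xor (map K hs) 0 = K n"
    using * eq by linarith
  then have vn: "foldr xor (map ?v hs) 0 = ?v n"
    using * eq cut_val_n \<open>?v n < 8\<close> by linarith
  have "K n \<le> ?K" using foldr_xor_le_sum [of "map K hs"] Kn by simp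
  have n: "n = 12 * c * ?K + (2 * c * ?R + ?r)"
    using sum_list_row_col [OF assms(1) pos] sum by (simp add: K_def R_def)
  have n': "n = 12 * c * K n + (2 * c * R n + col c n)"
    using sum_list_row_col [of c "[n]"] assms by (simp add: K_def R_def)
  have cn: "1 \<le> col c n" "col c n \<le> 2 * c" using row_col_decomp assms by auto
  have "R n < 6" by (simp add: R_def)
  then have "2 * c * R n \<le> 2 * c * 5" by (intro mult_left_mono) auto
  moreover have "1 \<le> ?r" using len row_col_decomp(2) [of _ c] by (cases hs) (auto simp: col_def)
  \<comment> \<open>Beyond its full periods \<open>n\<close> has at most \<open>12 * c\<close>,
    while the heaps have at least 1 beyond theirs. With the xor bound this makes the full periods
    cancel.\<close>
  ultimately have "12 * c * ?K < 12 * c * (K n + 1)"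
    using n n' cn distrib_left [of "12 * c" "K n" 1] by linarith
  then have "?K < K n + 1" by (simp only: mult_less_cancel1)
  then have "?K = K n" using \<open>K n \<le> ?K\<close> by simp
  then have sum': "2 * c * ?R + ?r = 2 * c * R n + col c n" using n n' by simp
  from len show False
  proof
    assume "length hs = 2"
    then obtain a b where ab: "hs = [a, b]" by (auto simp: length_Suc_conv numeral_2_eq_2)
    have "xor (?v a) (?v b) \<noteq> ?v n"
      using row_col_decomp [of a c] row_col_decomp [of b c] pos ab assms(1) cn \<open>R n < 6\<close> sum'
      by (intro period_val_no_option_2) simp_all
    then show False using vn ab by simp
  next
    assume "length hs = 2 * c + 1"
    moreover have "1 \<le> col c h" for h by (simp add: col_def)
    ultimately have "foldr xor (map ?v hs) 0 \<noteq> ?v n"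
      using cn \<open>R n < 6\<close> sum' by (intro period_val_no_option_odd) simp_all
    then show False using vn by simp
  qed
qed

section \<open>Options realising the smaller values\<close>

lemma option_pair:
  assumes "1 \<le> a" "1 \<le> b" "a + b = n"
  shows "xor (cut_val c a) (cut_val c b) \<in> options c n"
proof -
  have "[a, b] \<in> cut_moves {1, 2 * c} n" using assms by (auto simp: cut_moves_def)
  then show ?thesis unfolding options_def by (rule rev_image_eqI) simp
qed

lemma cut_val_one: "1 \<le> c \<Longrightarrow> cut_val c 1 = 0"
  using cut_val_eq [of 1 c 0 1 0] by (simp add: period_val_def)

text \<open>The two equal heaps \<open>m + 1\<close> cancel under xor and absorb any even surplus,
  and heaps of size 1 have value 0.\<close>

lemma option_triple:
  assumes "2 \<le> c" "1 \<le> a" "1 \<le> b" "1 \<le> d"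
    and "a + b + d + 2 * c \<le> n + 2" "even (a + b + d) = even n"
  shows "xor (cut_val c a) (xor (cut_val c b) (cut_val c d)) \<in> options c n"
proof -
  obtain m where m: "n + 2 = a + b + d + 2 * c + 2 * m"
  proof -
    have "even (n + 2 - (a + b + d + 2 * c))" using assms(5,6) by simp
    then show thesis using assms(5) that by (metis dvdE le_add_diff_inverse)
  qed
  \<comment> \<open>There are 3 + 2 + (2c - 4) = 2c + 1 heaps; the smallest total, at
    \<open>m = 0\<close>, gives the bound with \<open>n + 2\<close>.\<close>
  define hs where "hs = [a, b, d, m + 1, m + 1] @ replicate (2 * c - 4) 1"
  have "sum_list hs = n" using m assms(1) by (simp add: hs_def sum_list_replicate)
  then have "hs \<in> cut_moves {1, 2 * c} n" using assms by (auto simp: cut_moves_def hs_def)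
  moreover have "foldr xor (replicate k 0) (0::nat) = 0" for k by (induction k) auto
  then have "foldr xor (map (cut_val c) hs) 0 = xor (cut_val c a) (xor (cut_val c b) (cut_val c d))"
    using cut_val_one [of c] assms(1) by (simp add: hs_def flip: xor.assoc)
  ultimately show ?thesis unfolding options_def by (metis imageI)
qed

lemma option_single:
  assumes "2 \<le> c" "1 \<le> a" "a + 2 * c \<le> n" "even a = even n"
  shows "cut_val c a \<in> options c n"
  using option_triple [of c a 1 1 n] cut_val_one [of c] assms by simp

lemma xor_8_left:
  assumes "u < 8" "t < 8"
  shows "xor (8 * k + u) t = 8 * k + xor u (t::nat)"
  using xor_8 [OF assms, of k 0] by simp

text \<open>All full periods go into the first heap, so its multiple of 8 passes unchanged to the
  xor.\<close>

lemma option_pair_rows: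
  assumes "1 \<le> r" "r \<le> 2 * c" "R < 6" "1 \<le> s" "s \<le> 2 * c" "S < 6"
    and "n = 12 * c * k + 2 * c * R + r + (2 * c * S + s)"
  shows "8 * k + xor (period_val R r) (period_val S s) \<in> options c n"
  using option_pair [of "12 * c * k + 2 * c * R + r" "2 * c * S + s" n c] assms
    cut_val_eq [of r c R _ k] cut_val_eq [of s c S _ 0]
  by (simp add: xor_8_left period_val_less)

lemma option_single_row:
  assumes "2 \<le> c" "1 \<le> r" "r \<le> 2 * c" "R < 6" "even r = even n"
    and "12 * c * k + 2 * c * R + r + 2 * c \<le> n"
  shows "8 * k + period_val R r \<in> options c n"
  using option_single [of c "12 * c * k + 2 * c * R + r" n] assms cut_val_eq [of r c R _ k]
  by simp

lemma option_triple_rows: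
  assumes "2 \<le> c" "1 \<le> r" "r \<le> 2 * c" "R < 6" "1 \<le> s" "s \<le> 2 * c" "S < 6" "even (r + s) = odd n"
    and "12 * c * k + 2 * c * R + r + (2 * c * S + s) + 2 * c \<le> n + 1"
  shows "8 * k + xor (period_val R r) (period_val S s) \<in> options c n"
  using option_triple [of c "12 * c * k + 2 * c * R + r" "2 * c * S + s" 1 n] assms
    cut_val_eq [of r c R _ k] cut_val_eq [of s c S _ 0] cut_val_one [of c]
  by (auto simp: xor_8_left period_val_less)

lemma period_val_odd:
  assumes "odd r"
  shows "period_val 0 r = 0" "period_val (Suc 0) r = 2" "period_val 2 r = (if r = 1 then 1 else 5)"
    "period_val 3 r = 3" "period_val 4 r = 4" "period_val 5 r = 6"
  using assms by (auto simp: period_val_def)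

lemma period_val_even:
  assumes "even r"
  shows "period_val 0 r = 1" "period_val (Suc 0) r = 3" "period_val 2 r = 4"
    "period_val 3 r = 2" "period_val 4 r = 5" "period_val 5 r = 7"
  using assms by (auto simp: period_val_def)

lemma less_8_cases: "t < 8 \<Longrightarrow> t \<in> {0, 1, 2, 3, 4, 5, 6, 7 :: nat}"
  by auto

text \<open>
  Entry \<open>t\<close> of the lists is the offset from \<open>12 * c * k\<close> at which a cut into \<open>2 * c + 1\<close> heaps with value
  \<open>8 * k + t\<close> becomes available.
\<close>

lemma option_above_odd:
  assumes "2 \<le> c" "t < 8" "odd n"
    and "12 * c * k + [2 * c + 1, 6 * c + 1, 4 * c + 1, 8 * c + 1,
      10 * c + 1, 6 * c + 3, 12 * c + 1, 8 * c + 3] ! t \<le> n"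
  shows "8 * k + t \<in> options c n"
  \<comment> \<open>One instance for each \<open>t\<close>, in order. Odd columns never have value
    7, so it comes from 4 and 3 at even columns, with a third heap of size 1.\<close>
  using less_8_cases [OF assms(2)] assms
    option_single_row [of c 1 0 n k] option_single_row [of c 1 2 n k]
    option_single_row [of c 1 1 n k] option_single_row [of c 1 3 n k]
    option_single_row [of c 1 4 n k] option_single_row [of c 3 2 n k]
    option_single_row [of c 1 5 n k] option_triple_rows [of c 2 2 2 1 n k]
  by (elim insertE emptyE) (simp_all add: period_val_odd period_val_even)

lemma option_above_even:
  assumes "2 \<le> c" "t < 8" "even n"
    and "12 * c * k + [6 * c + 2, 2 * c + 2, 8 * c + 2, 4 * c + 2,
      6 * c + 2, 10 * c + 2, 8 * c + 2, 12 * c + 2] ! t \<le> n"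
  shows "8 * k + t \<in> options c n"
  \<comment> \<open>Even columns never have the values 0 and 6; these come from 1 xor 1 and 4 xor
    2.\<close>
  using less_8_cases [OF assms(2)] assms
    option_triple_rows [of c 1 2 2 0 n k] option_single_row [of c 2 0 n k]
    option_single_row [of c 2 3 n k] option_single_row [of c 2 1 n k]
    option_single_row [of c 2 2 n k] option_single_row [of c 2 4 n k]
    option_triple_rows [of c 2 2 1 1 n k] option_single_row [of c 2 5 n k]
  by (elim insertE emptyE) (simp_all add: period_val_odd period_val_even)

lemma option_below_cut_val:
  assumes c: "2 \<le> c" and "1 \<le> n" and w: "w < cut_val c n"
  shows "w \<in> options c n"
proof -
  define k R r where "k = row c n div 6" and "R = row c n mod 6" and "r = col c n"
  define l t where "l = w div 8" and "t = w mod 8"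
  have n: "n = 12 * c * k + 2 * c * R + r" and r: "1 \<le> r" "r \<le> 2 * c" and R: "R < 6"
    using sum_list_row_col [of c "[n]"] row_col_decomp [of n c] assms
    by (simp_all add: k_def R_def r_def)
  have w': "w = 8 * l + t" and t: "t < 8" by (simp_all add: l_def t_def)
  have "8 * l + t < 8 * k + period_val R r"
    using w cut_val_eq [OF r R n] w' by simp
  then have "l < k \<or> l = k \<and> t < period_val R r"
    using t period_val_less [of R r] by linarith
  moreover have "8 * l + t \<in> options c n" if "l < k"
  proof -
    have "12 * c * (l + 1) \<le> 12 * c * k" using that by (intro mult_left_mono) auto
    \<comment> \<open>A spare period brings \<open>n\<close> up to the largest offset for odd
      \<open>n\<close>; for even \<open>n\<close> parity supplies one more unit.\<close>
    then have le: "12 * c * l + 12 * c + 1 \<le> n" using n r by simp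
    show ?thesis
    proof (cases "odd n")
      case True
      have "[2 * c + 1, 6 * c + 1, 4 * c + 1, 8 * c + 1,
        10 * c + 1, 6 * c + 3, 12 * c + 1, 8 * c + 3] ! t \<le> 12 * c + 1"
        using less_8_cases [OF t] c by auto
      then show ?thesis using le by (intro option_above_odd [OF c t True]) linarith
    next
      case False
      have "[6 * c + 2, 2 * c + 2, 8 * c + 2, 4 * c + 2,
        6 * c + 2, 10 * c + 2, 8 * c + 2, 12 * c + 2] ! t \<le> 12 * c + 2"
        using less_8_cases [OF t] by auto
      moreover have "12 * c * l + 12 * c + 2 \<le> n"
        using le False by (cases "n = 12 * c * l + 12 * c + 1") auto
      ultimately show ?thesis using False by (intro option_above_even [OF c t]) auto
    qed
  qed
  moreover have "8 * k + t \<in> options c n" if tv: "t < period_val R r"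
  proof -
    have par: "even n = even r" using n by simp
    have A: "R = 0 \<or> R = 1 \<or> R = 2 \<or> R = 3 \<or> R = 4 \<or> R = 5" using R by auto
    show ?thesis
    proof (cases "odd r")
      case True
      \<comment> \<open>Within the same period, the pairs of \<open>R\<close> and \<open>t\<close>
        listed last are left to cuts into two heaps.\<close>
      have "[2 * c + 1, 6 * c + 1, 4 * c + 1, 8 * c + 1,
          10 * c + 1, 6 * c + 3, 12 * c + 1, 8 * c + 3] ! t \<le> 2 * c * R + r
        \<or> R = 1 \<and> t = 1 \<or> R = 2 \<and> r \<noteq> 1 \<and> t \<in> {1, 3, 4}"
        using A less_8_cases [OF t] tv True r
        by (elim disjE insertE emptyE) (auto simp: period_val_odd period_val_even split: if_splits)
      then consider (above) "12 * c * k + [2 * c + 1, 6 * c + 1, 4 * c + 1, 8 * c + 1,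
          10 * c + 1, 6 * c + 3, 12 * c + 1, 8 * c + 3] ! t \<le> n"
        | (one) "R = 1" "t = 1" | (two) "R = 2" "3 \<le> r" "t \<in> {1, 3, 4}"
        using n True r by (cases "r = 1"; cases "r = 2") auto
      then show ?thesis
      proof cases
        case above
        then show ?thesis using option_above_odd [OF c t] True par by simp
      next
        case one
        \<comment> \<open>A heap of size \<open>2 * c\<close> has value 1, and removing it from the
          first row block moves to row 0 in the same column, with value 0.\<close>
        then show ?thesis
          using option_pair_rows [of "2 * c" c 0 r 0 n k] n r c True
          by (simp add: period_val_odd period_val_even)
      next
        case two
        define s where "s = r - 2"
        have s: "r = s + 2" "1 \<le> s" using two by (simp_all add: s_def)
        \<comment> \<open>The three cuts have values 3 xor 2 = 1, 1 xor 2 = 3 and 0 xor 4 =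
          4.\<close>
        show ?thesis
          using two option_pair_rows [of 2 c 1 s 1 n k] option_pair_rows [of "2 * c" c 0 r 1 n k]
            option_pair_rows [of 1 c 0 "s + 1" 2 n k] n r c True s
          by (auto simp: period_val_odd period_val_even)
      qed
    next
      case False
      then have "2 \<le> r" using r by (cases "r = 1") auto
      then have "[6 * c + 2, 2 * c + 2, 8 * c + 2, 4 * c + 2,
          6 * c + 2, 10 * c + 2, 8 * c + 2, 12 * c + 2] ! t \<le> 2 * c * R + r
        \<or> R = 0 \<and> t = 0 \<or> R \<in> {1, 2} \<and> t \<in> {0, 2}"
        using A less_8_cases [OF t] tv False
        by (elim disjE insertE emptyE) (auto simp: period_val_odd period_val_even split: if_splits)
      then consider (above) "12 * c * k + [6 * c + 2, 2 * c + 2, 8 * c + 2, 4 * c + 2,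
          6 * c + 2, 10 * c + 2, 8 * c + 2, 12 * c + 2] ! t \<le> n"
        | (zero) "R = 0" "t = 0" | (one) "R = 1" "t \<in> {0, 2}" | (two) "R = 2" "t \<in> {0, 2}"
        using n by auto
      then show ?thesis
      proof cases
        case above
        then show ?thesis using option_above_even [OF c t] False par by simp
      next
        case zero
        then show ?thesis
          using option_pair_rows [of 1 c 0 "r - 1" 0 n k] n r c \<open>2 \<le> r\<close> False
          by (simp add: period_val_odd period_val_even)
      next
        case one
        \<comment> \<open>The cuts have values 1 xor 1 = 0 and 0 xor 2 = 2.\<close>
        then show ?thesis
          using option_pair_rows [of "2 * c" c 0 r 0 n k] option_pair_rows [of 1 c 0 "r - 1" 1 n k]
            n r c \<open>2 \<le> r\<close> False
          by (auto simp: period_val_odd period_val_even)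
      next
        case two
        \<comment> \<open>The cuts have values 2 xor 2 = 0 and 1 xor 3 = 2.\<close>
        then show ?thesis
          using option_pair_rows [of 1 c 1 "r - 1" 1 n k] option_pair_rows [of "2 * c" c 0 r 1 n k]
            n r c \<open>2 \<le> r\<close> False
          by (auto simp: period_val_odd period_val_even)
      qed
    qed
  qed
  ultimately show ?thesis unfolding w' by blast
qed

section \<open>Identification of the nim-sequence and transfer along \<open>phi\<close>\<close>

lemma nim_seq_eq_cut_val:
  assumes "2 \<le> c" "1 \<le> n"
  shows "nim_seq {1, 2 * c} n = cut_val c n"
  using assms(2)
proof (induction n rule: less_induct)
  case (less n)
  have "map (nim_seq {1, 2 * c}) hs = map (cut_val c) hs" if "hs \<in> cut_moves {1, 2 * c} n" for hs
    using that less.IH cut_moves_less [OF that] by (auto simp: cut_moves_def)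
  then have "nim_seq {1, 2 * c} n = mex (options c n)"
    unfolding options_def
    by (subst nim_seq.simps) (intro arg_cong [where f = mex] image_cong refl, simp only:)
  also have "\<dots> = cut_val c n"
    using assms(1) less.prems
    by (intro mex_eqI cut_val_not_option option_below_cut_val) auto
  finally show ?case .
qed

text \<open>A column enters \<open>period_val\<close> only through its parity and whether it is 1;
  the bounds make the image a column for rows of length 6.\<close>

lemma reduced_residue:
  assumes "3 \<le> c" "1 \<le> r" "r \<le> 2 * c"
  shows "1 \<le> reduced_residue c r" "reduced_residue c r \<le> 6"
    and "even (reduced_residue c r) = even r" "reduced_residue c r = 1 \<longleftrightarrow> r = 1"
proof -
  have "r = 2 * c" if "\<not> r < 2 * c - 1" "r \<noteq> 2 * c - 1" using that assms by linarith
  then show "1 \<le> reduced_residue c r" "reduced_residue c r \<le> 6"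
    and "even (reduced_residue c r) = even r" "reduced_residue c r = 1 \<longleftrightarrow> r = 1"
    using assms by (auto simp: reduced_residue_def)
qed

theorem theorem2:
  fixes c n :: nat
  assumes "3 \<le> c" and "1 \<le> n"
  shows "nim_seq {1, 2 * c} n = nim_seq {1, 6} (phi c 1 n)"
proof -
  let ?q = "row c n" and ?r = "col c n"
  let ?s = "reduced_residue c ?r"
  have r: "1 \<le> ?r" "?r \<le> 2 * c" using row_col_decomp assms by auto
  note s = reduced_residue [OF assms(1) r]
  have phi: "phi c 1 n = 6 * ?q + ?s" by (simp add: phi_def row_def col_def)
  \<comment> \<open>The cut-set \<open>{1, 6}\<close> is the case \<open>c = 3\<close> of the closed
    form.\<close>
  have "row 3 (6 * ?q + ?s) = ?q" "col 3 (6 * ?q + ?s) = ?s"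
    using row_col [of ?s 3 ?q] s by simp_all
  moreover have "period_val R ?s = period_val R ?r" for R
    using s by (simp add: period_val_def)
  ultimately have "cut_val 3 (6 * ?q + ?s) = cut_val c n"
    by (simp add: cut_val_def)
  then show ?thesis
    using nim_seq_eq_cut_val [of 3 "phi c 1 n"] nim_seq_eq_cut_val [of c n] assms s(1) phi
    by simp
qed

end
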